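(* Let $\Gamma(\tfrac18)=\bigl\{\sum_{k=0}^{N} a_k 8^k : N\ge 0,\ a_k\in\{0,2\}\bigr\}=\{0,2,16,18,\ldots\}$ and let $3\Gamma(\tfrac18)=\{3\gamma:\gamma\in\Gamma(\tfrac18)\}$. Then the set $E(3\Gamma(\tfrac18))=\{x\mapsto e^{2\pi i s x} : s\in 3\Gamma(\tfrac18)\}$ is an orthonormal basis for $L^2(\mu_{1/8})$.
   Context: For $\lambda\in(0,1)$, the Bernoulli measure $\mu_\lambda$ is the Borel probability measure on $\mathbb{R}$ that is the distribution of the random variable $\sum_{k=1}^\infty \omega_k\lambda^k$, where the $\omega_k$ are independent and take the values $\pm1$ with probability $\tfrac12$ each. Equivalently, it is the unique Borel probability measure with compact support satisfying $\mu_\lambda=\tfrac12(\mu_\lambda\circ\tau_+^{-1}+\mu_\lambda\circ\tau_-^{-1})$, where $\tau_\pm(x)=\lambda(x\pm1)$. Its Fourier transform is $\widehat\mu_\lambda(t)=\int e^{2\pi i x t}\,d\mu_\lambda(x)=\prod_{k=1}^\infty\cos(2\pi\lambda^k t)$. *)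

theory Defs
  imports "HOL-Probability.Probability"
begin

text \<open>The random signs are indexed by \<^typ>\<open>nat\<close>, so the k-th sign, for k from 1 onwards, is
  the coordinate \<open>k - 1\<close>.\<close>

definition sign_space :: "(nat \<Rightarrow> real) measure" where
  "sign_space = PiM UNIV (\<lambda>_. measure_pmf (pmf_of_set {-1, 1}))"

definition bernoulli_measure :: "real \<Rightarrow> real measure" where
  "bernoulli_measure l = distr sign_space borel (\<lambda>w. \<Sum>k. w k * l ^ Suc k)"

text \<open>The map is measurable, so \<^const>\<open>distr\<close> does yield its law.\<close>

lemma measurable_bernoulli_sum:
  "(\<lambda>w. \<Sum>k. w k * l ^ Suc k) \<in> borel_measurable sign_space"
proof -
  have "(\<lambda>w. w k) \<in> borel_measurable sign_space" for k
  proof -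
    have "(\<lambda>w. w k) \<in> sign_space \<rightarrow>\<^sub>M measure_pmf (pmf_of_set {-1, 1})"
      unfolding sign_space_def by (rule measurable_component_singleton) simp
    moreover have "(\<lambda>x. x) \<in> measure_pmf (pmf_of_set {-1, 1}) \<rightarrow>\<^sub>M (borel :: real measure)"
      by simp
    ultimately show ?thesis by (rule measurable_compose)
  qed
  then show ?thesis by measurable
qed

lemma prob_space_bernoulli_measure: "prob_space (bernoulli_measure l)"
proof -
  have "prob_space sign_space"
    unfolding sign_space_def by (intro prob_space_PiM prob_space_measure_pmf)
  then show ?thesis
    unfolding bernoulli_measure_def
    by (rule prob_space.prob_space_distr) (rule measurable_bernoulli_sum)
qed

text \<open>The space \<open>L\<^sup>2(M)\<close> is represented by functions rather than by classes modulo null sets.\<close>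

definition L2 :: "'a measure \<Rightarrow> ('a \<Rightarrow> complex) set" where
  "L2 M = {f \<in> borel_measurable M. integrable M (\<lambda>x. (cmod (f x))\<^sup>2)}"

definition L2_inner :: "'a measure \<Rightarrow> ('a \<Rightarrow> complex) \<Rightarrow> ('a \<Rightarrow> complex) \<Rightarrow> complex" where
  "L2_inner M f g = (\<integral>x. f x * cnj (g x) \<partial>M)"

definition L2_norm :: "'a measure \<Rightarrow> ('a \<Rightarrow> complex) \<Rightarrow> real" where
  "L2_norm M f = sqrt (\<integral>x. (cmod (f x))\<^sup>2 \<partial>M)"

text \<open>An orthonormal basis is an orthonormal set whose finite linear span is dense. Two distinct
  functions that agree almost everywhere cannot both belong to an orthonormal set here, so the
  passage to classes is injective on such a set.\<close>

definition orthonormal_set :: "'a measure \<Rightarrow> ('a \<Rightarrow> complex) set \<Rightarrow> bool" where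
  "orthonormal_set M B \<longleftrightarrow>
     B \<subseteq> L2 M \<and> (\<forall>f\<in>B. \<forall>g\<in>B. L2_inner M f g = (if f = g then 1 else 0))"

definition orthonormal_basis :: "'a measure \<Rightarrow> ('a \<Rightarrow> complex) set \<Rightarrow> bool" where
  "orthonormal_basis M B \<longleftrightarrow> orthonormal_set M B \<and>
     (\<forall>f\<in>L2 M. \<forall>\<epsilon>>0. \<exists>F c. finite F \<and> F \<subseteq> B \<and>
        L2_norm M (\<lambda>x. f x - (\<Sum>g\<in>F. c g * g x)) < \<epsilon>)"

definition exponentials :: "real set \<Rightarrow> (real \<Rightarrow> complex) set" where
  "exponentials S = (\<lambda>s x. exp (2 * of_real pi * \<i> * of_real s * of_real x)) ` S"

definition Gamma_eighth :: "real set" where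
  "Gamma_eighth = {\<Sum>k=0..N. a k * 8 ^ k | (N :: nat) a. \<forall>k\<in>{0..N}. a k \<in> {0, 2}}"

end

theory Submission imports Defs begin

text \<open>Write \<open>\<phi>\<close> for the Fourier transform of the measure. Self-similarity gives
  \<open>\<phi> t = cos (\<pi> t / 4) \<phi> (t / 8)\<close>, which yields orthogonality digit by digit. For completeness,
  let \<open>Q t\<close> be the sum of \<open>\<bar>\<phi> (t - \<gamma>)\<bar>\<^sup>2\<close> over the spectrum; since \<open>6 / 4\<close> is an odd multiple of
  one half, \<open>Q t = cos\<^sup>2 (\<pi> t / 4) Q (t / 8) + sin\<^sup>2 (\<pi> t / 4) Q ((t - 6) / 8)\<close>, a convex combination.
  On \<open>[-1,1]\<close>, which both branches preserve, iterating the first branch leads to \<open>Q 0 = 1\<close> with total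
  weight \<open>\<bar>\<phi> t\<bar>\<^sup>2\<close>, bounded away from 0, so \<open>Q = 1\<close> there and then everywhere. Hence every exponential
  lies in the closed span, and all exponentials together are dense by the Stone-Weierstrass theorem.\<close>

subsection \<open>The Fourier transform of a Bernoulli measure\<close>

definition expo :: "real \<Rightarrow> real \<Rightarrow> complex" where
  "expo s x = exp (2 * of_real pi * \<i> * of_real s * of_real x)"

lemma exponentials_eq: "exponentials S = expo ` S"
  unfolding exponentials_def expo_def ..

lemma expo_eq_cis: "expo s x = cis (2 * pi * s * x)"
  by (simp add: expo_def cis_conv_exp mult_ac)

lemma expo_0 [simp]: "expo 0 x = 1"
  by (simp add: expo_eq_cis)

lemma norm_expo [simp]: "cmod (expo s x) = 1"
  by (simp add: expo_eq_cis)

lemma cnj_expo [simp]: "cnj (expo s x) = expo (- s) x"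
  by (simp add: expo_eq_cis cis_cnj)

lemma expo_mult: "expo s x * expo t x = expo (s + t) x"
  by (simp add: expo_eq_cis cis_mult algebra_simps)

lemma expo_scale: "expo s (c * x) = expo (s * c) x"
  by (simp add: expo_eq_cis mult_ac)

lemma expo_add_right: "expo s (x + y) = expo s x * expo s y"
  by (simp add: expo_eq_cis cis_mult algebra_simps)

lemma continuous_expo: "continuous_on A (expo s)"
  unfolding expo_def by (intro continuous_intros)

lemma borel_measurable_expo [measurable]: "expo s \<in> borel_measurable borel"
  by (intro borel_measurable_continuous_onI continuous_expo)

lemma sets_bernoulli_measure [simp, measurable_cong]: "sets (bernoulli_measure l) = sets borel"
  by (simp add: bernoulli_measure_def)

lemma space_bernoulli_measure [simp]: "space (bernoulli_measure l) = UNIV"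
  by (simp add: bernoulli_measure_def)

section \<open>Signs almost surely, and the support of the measure\<close>

text \<open>The product space contains all real sequences, because each factor is a measure on the
  whole type. Series identities that need genuine signs are therefore proved almost everywhere, and
  this null set is the one to discard.\<close>

lemma AE_sign_space: "AE w in sign_space. \<forall>k. w k \<in> {-1, 1}"
proof -
  have "AE x in measure_pmf (pmf_of_set {-1, 1 :: real}). x \<in> {-1, 1}"
    by (subst AE_measure_pmf_iff) (simp add: set_pmf_of_set)
  then have "AE w in sign_space. w k \<in> {-1, 1}" for k
    unfolding sign_space_def by (intro AE_PiM_component) (auto intro: prob_space_measure_pmf)
  then show ?thesis
    by (simp add: AE_all_countable)
qed

lemma summable_signed_powers:
  fixes w :: "nat \<Rightarrow> real"
  assumes "\<forall>k. w k \<in> {-1, 1}" "\<bar>l\<bar> < 1"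
  shows "summable (\<lambda>k. norm (w k * l ^ Suc k))"
proof -
  have "norm (w k * l ^ Suc k) = \<bar>l\<bar> * \<bar>l\<bar> ^ k" for k
    using assms(1)[rule_format, of k] by (auto simp: abs_mult power_abs)
  then show ?thesis
    using assms(2) by (simp add: summable_geometric)
qed

text \<open>The random series is dominated by a geometric series. For ratio 1/8 the radius is 1/7,
  which later places the support inside [-1,1].\<close>

lemma AE_bernoulli_measure_bounded:
  assumes "\<bar>l\<bar> < 1"
  shows "AE x in bernoulli_measure l. \<bar>x\<bar> \<le> \<bar>l\<bar> / (1 - \<bar>l\<bar>)"
  unfolding bernoulli_measure_def
proof (subst AE_distr_iff[OF measurable_bernoulli_sum])
  show "AE w in sign_space. \<bar>\<Sum>k. w k * l ^ Suc k\<bar> \<le> \<bar>l\<bar> / (1 - \<bar>l\<bar>)"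
    using AE_sign_space
  proof eventually_elim
    fix w :: "nat \<Rightarrow> real" assume w: "\<forall>k. w k \<in> {-1, 1}"
    have eq: "norm (w k * l ^ Suc k) = \<bar>l\<bar> * \<bar>l\<bar> ^ k" for k
      using w[rule_format, of k] by (auto simp: abs_mult power_abs)
    have "norm (\<Sum>k. w k * l ^ Suc k) \<le> (\<Sum>k. norm (w k * l ^ Suc k))"
      by (rule summable_norm[OF summable_signed_powers[OF w assms]])
    also have "\<dots> = \<bar>l\<bar> * (1 / (1 - \<bar>l\<bar>))"
      unfolding eq using assms by (subst suminf_mult) (auto simp: summable_geometric suminf_geometric)
    finally show "\<bar>\<Sum>k. w k * l ^ Suc k\<bar> \<le> \<bar>l\<bar> / (1 - \<bar>l\<bar>)" by simp
  qed
qed simp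

section \<open>Basic properties and the self-similarity of the transform\<close>

definition bernoulli_ft :: "real \<Rightarrow> real \<Rightarrow> complex" where
  "bernoulli_ft l t = (\<integral>x. expo t x \<partial>bernoulli_measure l)"

lemma integrable_expo [simp]: "integrable (bernoulli_measure l) (expo t)"
proof -
  interpret prob_space "bernoulli_measure l" by (rule prob_space_bernoulli_measure)
  show ?thesis by (rule integrable_const_bound[of _ 1]) auto
qed

lemma bernoulli_ft_0 [simp]: "bernoulli_ft l 0 = 1"
proof -
  interpret prob_space "bernoulli_measure l" by (rule prob_space_bernoulli_measure)
  show ?thesis using prob_space by (simp add: bernoulli_ft_def)
qed

lemma bernoulli_ft_minus: "bernoulli_ft l (- t) = cnj (bernoulli_ft l t)"
  using Bochner_Integration.integral_cnj[of "bernoulli_measure l" "expo t"] by (simp add: bernoulli_ft_def)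

lemma norm_bernoulli_ft_le: "cmod (bernoulli_ft l t) \<le> 1"
proof -
  interpret prob_space "bernoulli_measure l" by (rule prob_space_bernoulli_measure)
  have "cmod (bernoulli_ft l t) \<le> (\<integral>x. cmod (expo t x) \<partial>bernoulli_measure l)"
    unfolding bernoulli_ft_def by (rule integral_norm_bound)
  also have "\<dots> = 1" using prob_space by simp
  finally show ?thesis .
qed

lemma integral_bernoulli_measure_expo:
  "bernoulli_ft l t = (\<integral>w. expo t (\<Sum>k. w k * l ^ Suc k) \<partial>sign_space)"
  unfolding bernoulli_ft_def bernoulli_measure_def
  by (rule integral_distr[OF measurable_bernoulli_sum]) simp

text \<open>The sum over all signs is its first term plus \<open>l\<close> times an independent copy of itself.\<close>

lemma bernoulli_ft_rec:
  assumes "\<bar>l\<bar> < 1"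
  shows "bernoulli_ft l t = of_real (cos (2 * pi * l * t)) * bernoulli_ft l (l * t)"
proof -
  define P where "P = measure_pmf (pmf_of_set {-1, 1 :: real})"
  define X where "X w = (\<Sum>k. w k * l ^ Suc k)" for w :: "nat \<Rightarrow> real"
  have X [measurable]: "X \<in> borel_measurable sign_space"
    unfolding X_def by (rule measurable_bernoulli_sum)
  interpret P: prob_space P unfolding P_def by (rule prob_space_measure_pmf)
  interpret S: prob_space sign_space
    unfolding sign_space_def by (intro prob_space_PiM prob_space_measure_pmf)
  interpret seq: sequence_space P ..
  interpret PS: pair_prob_space P sign_space ..
  have sS: "sign_space = PiM UNIV (\<lambda>_. P)" by (simp add: sign_space_def P_def)
  \<comment> \<open>Putting an independent sign in front of a sign sequence reproduces the law of
    the sequence; this is the source of self-similarity.\<close>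
  have iter: "distr (P \<Otimes>\<^sub>M sign_space) sign_space (\<lambda>(s, w). case_nat s w) = sign_space"
    unfolding sS by (rule seq.PiM_iter)
  have m [measurable]: "(\<lambda>(s, w). case_nat s w) \<in> P \<Otimes>\<^sub>M sign_space \<rightarrow>\<^sub>M sign_space"
    unfolding sS by measurable
  have id_P [measurable]: "(\<lambda>x. x) \<in> borel_measurable P" by (simp add: P_def)
  \<comment> \<open>Splitting off the first term needs a summable series, hence the restriction to
    sign sequences.\<close>
  have step: "X (case_nat s w) = l * s + l * X w" if w: "\<forall>k. w k \<in> {-1, 1}" for s w
  proof -
    have sm: "summable (\<lambda>k. w k * l ^ Suc k)"
      by (rule summable_norm_cancel[OF summable_signed_powers[OF w assms]])
    have eq: "(\<lambda>k. (case Suc k of 0 \<Rightarrow> s | Suc x \<Rightarrow> w x) * l ^ Suc (Suc k))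
        = (\<lambda>k. l * (w k * l ^ Suc k))"
      by (auto simp: fun_eq_iff)
    have "summable (\<lambda>k. (case Suc k of 0 \<Rightarrow> s | Suc x \<Rightarrow> w x) * l ^ Suc (Suc k))"
      unfolding eq by (rule summable_mult[OF sm])
    then have "summable (\<lambda>k. (case k of 0 \<Rightarrow> s | Suc x \<Rightarrow> w x) * l ^ Suc k)"
      by (subst summable_Suc_iff[symmetric])
    from suminf_split_head[OF this] have "X (case_nat s w) = (\<Sum>k. l * (w k * l ^ Suc k)) + l * s"
      unfolding X_def eq by (simp add: mult.commute)
    also have "(\<Sum>k. l * (w k * l ^ Suc k)) = l * X w"
      unfolding X_def by (rule suminf_mult[OF sm])
    finally show ?thesis by simp
  qed
  have int: "integrable (P \<Otimes>\<^sub>M sign_space) (\<lambda>z. expo t (X (case z of (s, w) \<Rightarrow> case_nat s w)))"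
    by (rule PS.integrable_const_bound[of _ 1]) auto
  have "bernoulli_ft l t = (\<integral>w. expo t (X w) \<partial>distr (P \<Otimes>\<^sub>M sign_space) sign_space (\<lambda>(s, w). case_nat s w))"
    unfolding iter by (simp add: integral_bernoulli_measure_expo X_def)
  also have "\<dots> = (\<integral>z. expo t (X (case z of (s, w) \<Rightarrow> case_nat s w)) \<partial>(P \<Otimes>\<^sub>M sign_space))"
    by (rule integral_distr[OF m]) measurable
  also have "\<dots> = (\<integral>s. (\<integral>w. expo t (X (case_nat s w)) \<partial>sign_space) \<partial>P)"
    using PS.integral_fst'[OF int] by simp
  also have "\<dots> = (\<integral>s. expo (l * t) s * bernoulli_ft l (l * t) \<partial>P)"
  proof (rule Bochner_Integration.integral_cong[OF refl])
    fix s assume "s \<in> space P"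
    have [measurable]: "(\<lambda>w. case_nat s w) \<in> sign_space \<rightarrow>\<^sub>M sign_space"
      using measurable_compose[OF measurable_Pair1' m] \<open>s \<in> space P\<close> by simp
    have "(\<integral>w. expo t (X (case_nat s w)) \<partial>sign_space) = (\<integral>w. expo (l * t) s * expo (l * t) (X w) \<partial>sign_space)"
    proof (rule integral_cong_AE)
      show "AE w in sign_space. expo t (X (case_nat s w)) = expo (l * t) s * expo (l * t) (X w)"
        using AE_sign_space
      proof eventually_elim
        fix w :: "nat \<Rightarrow> real" assume "\<forall>k. w k \<in> {-1, 1}"
        from step[OF this] show "expo t (X (case_nat s w)) = expo (l * t) s * expo (l * t) (X w)"
          by (simp only: expo_add_right expo_scale mult.commute[of t l])
      qed
    qed measurable
    then show "(\<integral>w. expo t (X (case_nat s w)) \<partial>sign_space) = expo (l * t) s * bernoulli_ft l (l * t)"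
      by (simp add: integral_bernoulli_measure_expo X_def)
  qed
  \<comment> \<open>The outer integral is the mean over two signs, and the mean of two conjugate
    exponentials is a cosine.\<close>
  also have "\<dots> = (\<Sum>s\<in>{-1, 1}. expo (l * t) s * bernoulli_ft l (l * t)) / of_nat (card {-1, 1 :: real})"
    unfolding P_def by (subst integral_measure_pmf[of "{-1, 1}"])
      (auto simp: set_pmf_of_set pmf_of_set scaleR_conv_of_real field_simps)
  also have "\<dots> = of_real (cos (2 * pi * l * t)) * bernoulli_ft l (l * t)"
    by (simp add: expo_eq_cis complex_eq_iff algebra_simps)
  finally show ?thesis .
qed

text \<open>The real part of the transform is the mean of cos (2 pi t x) over the support. The
  second hypothesis keeps the argument within [-pi, pi], so the cosine is smallest at the edge of
  the support. This bound gives both non-vanishing near 0 and the limit 1 at 0 without the infinite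
  product.\<close>

lemma norm_bernoulli_ft_ge:
  assumes "\<bar>l\<bar> < 1" "2 * \<bar>t\<bar> * \<bar>l\<bar> \<le> 1 - \<bar>l\<bar>"
  shows "cmod (bernoulli_ft l t) \<ge> cos (2 * pi * \<bar>t\<bar> * (\<bar>l\<bar> / (1 - \<bar>l\<bar>)))"
proof -
  interpret prob_space "bernoulli_measure l" by (rule prob_space_bernoulli_measure)
  define R where "R = \<bar>l\<bar> / (1 - \<bar>l\<bar>)"
  have R: "2 * \<bar>t\<bar> * R \<le> 1" using assms by (simp add: R_def field_simps)
  have "cos (2 * pi * \<bar>t\<bar> * R) = (\<integral>x. cos (2 * pi * \<bar>t\<bar> * R) \<partial>bernoulli_measure l)"
    using prob_space by simp
  also have "\<dots> \<le> (\<integral>x. Re (expo t x) \<partial>bernoulli_measure l)"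
  proof (rule integral_mono_AE)
    show "AE x in bernoulli_measure l. cos (2 * pi * \<bar>t\<bar> * R) \<le> Re (expo t x)"
      using AE_bernoulli_measure_bounded[OF assms(1)]
    proof eventually_elim
      fix x assume "\<bar>x\<bar> \<le> \<bar>l\<bar> / (1 - \<bar>l\<bar>)"
      then have "\<bar>2 * pi * t * x\<bar> \<le> 2 * pi * \<bar>t\<bar> * R"
        unfolding R_def abs_mult by (intro mult_mono) auto
      moreover have "2 * pi * \<bar>t\<bar> * R \<le> pi"
        using mult_left_mono[OF R, of pi] by (simp add: mult_ac)
      ultimately have "cos (2 * pi * \<bar>t\<bar> * R) \<le> cos \<bar>2 * pi * t * x\<bar>"
        by (intro cos_monotone_0_pi_le) auto
      then show "cos (2 * pi * \<bar>t\<bar> * R) \<le> Re (expo t x)"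
        by (simp add: expo_eq_cis)
    qed
  qed auto
  also have "\<dots> = Re (bernoulli_ft l t)"
    by (simp add: bernoulli_ft_def)
  also have "\<dots> \<le> cmod (bernoulli_ft l t)" by (rule complex_Re_le_cmod)
  finally show ?thesis unfolding R_def .
qed

subsection \<open>The spectrum and the projection sums\<close>

abbreviation ft8 :: "real \<Rightarrow> complex" where
  "ft8 \<equiv> bernoulli_ft (1/8)"

lemma ft8_rec: "ft8 t = of_real (cos (pi * t / 4)) * ft8 (t / 8)"
  using bernoulli_ft_rec[of "1/8" t] by simp

lemma norm_ft8_ge:
  assumes "\<bar>t\<bar> \<le> 1"
  shows "cos (2 * pi * \<bar>t\<bar> / 7) \<le> cmod (ft8 t)"
  using norm_bernoulli_ft_ge[of "1/8" t] assms by simp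

text \<open>The elements of \<open>3\<Gamma>(1/8)\<close> with at most \<open>n\<close> digits, generated from the least significant one.\<close>

primrec spectrum :: "nat \<Rightarrow> real set" where
  "spectrum 0 = {0}"
| "spectrum (Suc n) = (\<lambda>\<gamma>. 8 * \<gamma>) ` spectrum n \<union> (\<lambda>\<gamma>. 8 * \<gamma> + 6) ` spectrum n"

section \<open>Arithmetic of the digit expansions\<close>

lemma finite_spectrum [simp]: "finite (spectrum n)"
  by (induction n) auto

text \<open>Divisibility by 6 makes shifts by \<open>8 * \<gamma>\<close> whole periods of the
  cosine factor and separates the two branches of the recursion.\<close>

lemma spectrum_int: "\<gamma> \<in> spectrum n \<Longrightarrow> \<exists>m::int. \<gamma> = 6 * of_int m"
proof (induction n arbitrary: \<gamma>)
  case 0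
  then show ?case by (auto intro: exI[of _ 0])
next
  case (Suc n)
  then obtain \<delta> d where \<delta>: "\<delta> \<in> spectrum n" "\<gamma> = 8 * \<delta> + 6 * of_int d" "d \<in> {0, 1 :: int}"
    by (auto intro: that[of _ 0] that[of _ 1])
  obtain m :: int where "\<delta> = 6 * of_int m" using Suc.IH \<delta>(1) by blast
  then have "\<gamma> = 6 * of_int (8 * m + d)" using \<delta>(2) by simp
  then show ?case by blast
qed

text \<open>After division by 6, the branches lie in the residue classes 0 and 1 modulo 8.\<close>

lemma spectrum_branches_disjoint: "(\<lambda>\<gamma>. 8 * \<gamma>) ` spectrum n \<inter> (\<lambda>\<gamma>. 8 * \<gamma> + 6) ` spectrum n = {}"
proof -
  have False if xy: "8 * x = 8 * y + 6" "x \<in> spectrum n" "y \<in> spectrum n" for x y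
  proof -
    obtain a b :: int where "x = 6 * of_int a" "y = 6 * of_int b"
      using spectrum_int[OF xy(2)] spectrum_int[OF xy(3)] by blast
    with xy(1) have "real_of_int (48 * a) = real_of_int (48 * b + 6)" by simp
    then have "48 * a = 48 * b + 6" by (simp only: of_int_eq_iff)
    then show False by presburger
  qed
  then show ?thesis by blast
qed

text \<open>The recursion inserts a lowest digit, not a leading zero, so the inclusion comes from
  applying both branches to the previous inclusion, starting from 0.\<close>

lemma spectrum_subset_Suc: "spectrum n \<subseteq> spectrum (Suc n)"
proof (induction n)
  case (Suc n)
  then show ?case by (subst (1 2) spectrum.simps(2)) blast
qed auto

lemma spectrum_mono: "m \<le> n \<Longrightarrow> spectrum m \<subseteq> spectrum n"
  by (rule lift_Suc_mono_le[of spectrum]) (rule spectrum_subset_Suc)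

lemma zero_in_Gamma_eighth: "0 \<in> Gamma_eighth"
  unfolding Gamma_eighth_def by (auto intro!: exI[of _ 0] exI[of _ "\<lambda>_. 0"])

lemma Gamma_eighth_step:
  assumes "x \<in> Gamma_eighth" "d \<in> {0, 2}"
  shows "8 * x + d \<in> Gamma_eighth"
proof -
  obtain N a where a: "x = (\<Sum>k=0..N. a k * 8 ^ k)" "\<forall>k\<in>{0..N}. a k \<in> {0, 2}"
    using assms(1) unfolding Gamma_eighth_def by blast
  \<comment> \<open>Multiplication by 8 moves every digit up one place, and
    \<open>case_nat d a\<close> puts \<open>d\<close> in the free lowest place.\<close>
  have "8 * x + d = (\<Sum>k=0..Suc N. case_nat d a k * 8 ^ k)"
    unfolding a(1) sum.atLeast0_atMost_Suc_shift
    by (simp add: sum_distrib_left mult_ac)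
  moreover have "\<forall>k\<in>{0..Suc N}. case_nat d a k \<in> {0, 2}"
    using a(2) assms(2) by (auto split: nat.split)
  ultimately show ?thesis unfolding Gamma_eighth_def by blast
qed

text \<open>Peeling off the lowest digit follows the recursion of \<open>spectrum\<close>. The level
  is \<open>Suc N\<close> because the indices 0 to \<open>N\<close> carry \<open>Suc N\<close>
  digits.\<close>

lemma digit_sum_in_spectrum:
  assumes "\<forall>k\<in>{0..N}. a k \<in> {0, 2}"
  shows "3 * (\<Sum>k=0..N. a k * 8 ^ k) \<in> spectrum (Suc N)"
  using assms
proof (induction N arbitrary: a)
  case 0
  then show ?case by auto
next
  case (Suc N)
  define S where "S = (\<Sum>k=0..N. a (Suc k) * 8 ^ k)"
  have "3 * S \<in> spectrum (Suc N)"
    unfolding S_def using Suc.prems by (intro Suc.IH) auto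
  moreover have "3 * (\<Sum>k=0..Suc N. a k * 8 ^ k) = 8 * (3 * S) + 3 * a 0"
    unfolding sum.atLeast0_atMost_Suc_shift S_def by (simp add: sum_distrib_left mult_ac)
  moreover have "a 0 = 0 \<or> a 0 = 2" using Suc.prems by auto
  ultimately show ?case by (subst spectrum.simps(2)) auto
qed

lemma three_Gamma_eighth: "(\<lambda>\<gamma>. 3 * \<gamma>) ` Gamma_eighth = (\<Union>n. spectrum n)"
proof
  show "(\<lambda>\<gamma>. 3 * \<gamma>) ` Gamma_eighth \<subseteq> (\<Union>n. spectrum n)"
  proof
    fix x assume "x \<in> (\<lambda>\<gamma>. 3 * \<gamma>) ` Gamma_eighth"
    then obtain N a where "x = 3 * (\<Sum>k=0..N. a k * 8 ^ k)" "\<forall>k\<in>{0..N}. a k \<in> {0, 2}"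
      unfolding Gamma_eighth_def by blast
    then show "x \<in> (\<Union>n. spectrum n)" using digit_sum_in_spectrum by blast
  qed
  have "\<exists>x\<in>Gamma_eighth. \<gamma> = 3 * x" if "\<gamma> \<in> spectrum n" for \<gamma> n
    using that
  proof (induction n arbitrary: \<gamma>)
    case 0
    then show ?case using zero_in_Gamma_eighth by auto
  next
    case (Suc n)
    then obtain \<delta> d where \<delta>: "\<delta> \<in> spectrum n" "\<gamma> = 8 * \<delta> + 3 * d" "d \<in> {0, 2}"
      by (auto intro: that[of _ 0] that[of _ 2])
    obtain x where x: "x \<in> Gamma_eighth" "\<delta> = 3 * x" using Suc.IH \<delta>(1) by blast
    have "\<gamma> = 3 * (8 * x + d)" using \<delta>(2) x(2) by simp
    then show ?case using Gamma_eighth_step[OF x(1) \<delta>(3)] by blast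
  qed
  then show "(\<Union>n. spectrum n) \<subseteq> (\<lambda>\<gamma>. 3 * \<gamma>) ` Gamma_eighth" by blast
qed

section \<open>Orthogonality of the exponentials\<close>

text \<open>With \<open>\<gamma> = 6 * m\<close> the shift by \<open>8 * \<gamma>\<close> changes
  the angle by 12 pi m, a whole number of periods. The extra 6 contributes 3/2 pi and turns the
  cosine into a sine up to sign, which the square removes.\<close>

lemma cos_pi_diff_spectrum:
  assumes "\<gamma> \<in> spectrum n"
  shows "cos (pi * (t - 8 * \<gamma>) / 4) = cos (pi * t / 4)"
    and "(cos (pi * (t - (8 * \<gamma> + 6)) / 4))\<^sup>2 = (sin (pi * t / 4))\<^sup>2"
proof -
  obtain m :: int where m: "\<gamma> = 6 * of_int m" using spectrum_int assms by blast
  have per: "cos (x - 2 * pi * of_int (6 * m)) = cos x" for x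
    unfolding cos_diff cos_int_2pin sin_int_2pin by simp
  have "pi * (t - 8 * \<gamma>) / 4 = pi * t / 4 - 2 * pi * of_int (6 * m)"
    unfolding m by (simp add: field_simps)
  then show "cos (pi * (t - 8 * \<gamma>) / 4) = cos (pi * t / 4)" by (simp only: per)
  have "pi * (t - (8 * \<gamma> + 6)) / 4 = (pi * t / 4 - 3 / 2 * pi) - 2 * pi * of_int (6 * m)"
    unfolding m by (simp add: field_simps)
  then have "cos (pi * (t - (8 * \<gamma> + 6)) / 4) = cos (pi * t / 4 - 3 / 2 * pi)"
    by (simp only: per)
  also have "\<dots> = - sin (pi * t / 4)"
    unfolding cos_diff cos_3over2_pi sin_3over2_pi by simp
  finally show "(cos (pi * (t - (8 * \<gamma> + 6)) / 4))\<^sup>2 = (sin (pi * t / 4))\<^sup>2" by simp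
qed

text \<open>Equal lowest digits cancel, and \<open>ft8_rec\<close> passes to the remaining digits.
  Different lowest digits put the angle at an odd multiple of pi/2, where the cosine factor
  vanishes.\<close>

lemma ft8_spectrum_diff:
  assumes "x \<in> spectrum n" "y \<in> spectrum n" "x \<noteq> y"
  shows "ft8 (x - y) = 0"
  using assms
proof (induction n arbitrary: x y)
  case 0
  then show ?case by simp
next
  case (Suc n)
  obtain u c where u: "u \<in> spectrum n" "x = 8 * u + c" "c = 0 \<or> c = 6"
    using Suc.prems(1) by force
  obtain v d where v: "v \<in> spectrum n" "y = 8 * v + d" "d = 0 \<or> d = 6"
    using Suc.prems(2) by force
  show ?case
  proof (cases "c = d")
    case True
    then have "ft8 (u - v) = 0" using Suc u v by auto
    then show ?thesis using ft8_rec[of "x - y"] True u v by (simp add: diff_divide_distrib)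
  next
    case False
    have "(cos (pi * (x - y) / 4))\<^sup>2 = 0"
    proof (cases "d = 0")
      case True
      have "cos (pi * (x - y) / 4) = cos (pi * (8 * u + 6) / 4)"
        using cos_pi_diff_spectrum(1)[OF v(1), of x] True False u v by auto
      \<comment> \<open>The periodicity rule only subtracts \<open>8 * u\<close>, so the angle is
        first reflected by evenness of the cosine.\<close>
      also have "\<dots> = cos (pi * (- 6 - 8 * u) / 4)"
      proof -
        have "pi * (- 6 - 8 * u) / 4 = - (pi * (8 * u + 6) / 4)" by (simp add: field_simps)
        then show ?thesis by (simp only: cos_minus)
      qed
      also have "\<dots> = cos (- (3 / 2 * pi))"
        using cos_pi_diff_spectrum(1)[OF u(1), of "- 6"] by (simp add: algebra_simps)
      also have "\<dots> = 0" by (simp only: cos_minus cos_3over2_pi)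
      finally show ?thesis by simp
    next
      case nz: False
      have "(cos (pi * (x - y) / 4))\<^sup>2 = (sin (pi * (8 * u) / 4))\<^sup>2"
        using cos_pi_diff_spectrum(2)[OF v(1), of x] nz False u v by auto
      moreover obtain m :: int where "u = 6 * of_int m" using spectrum_int u(1) by blast
      then have "pi * (8 * u) / 4 = 2 * pi * of_int (6 * m)" by simp
      ultimately show ?thesis by (simp only: sin_int_2pin) simp
    qed
    then show ?thesis using ft8_rec[of "x - y"] by simp
  qed
qed

text \<open>\<open>Q n t\<close> is the squared norm of the projection of the exponential of frequency \<open>t\<close> onto the
  span of those with frequencies in \<open>spectrum n\<close>.\<close>

definition Q :: "nat \<Rightarrow> real \<Rightarrow> real" where
  "Q n t = (\<Sum>\<gamma>\<in>spectrum n. (cmod (ft8 (t - \<gamma>)))\<^sup>2)"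

lemma Q_0: "Q 0 t = (cmod (ft8 t))\<^sup>2"
  by (simp add: Q_def)

lemma Q_nonneg: "0 \<le> Q n t"
  unfolding Q_def by (intro sum_nonneg) simp

section \<open>Recursion and limit of the projection sums\<close>

lemma norm_ft8_rec: "(cmod (ft8 t))\<^sup>2 = (cos (pi * t / 4))\<^sup>2 * (cmod (ft8 (t / 8)))\<^sup>2"
  by (subst ft8_rec) (simp add: norm_mult power_mult_distrib)

text \<open>Splitting the spectrum by the lowest digit makes the cosine factor the same for all
  terms of a branch, so it leaves the sum.\<close>

lemma Q_Suc: "Q (Suc n) t = (cos (pi * t / 4))\<^sup>2 * Q n (t / 8) + (sin (pi * t / 4))\<^sup>2 * Q n ((t - 6) / 8)"
proof -
  have "Q (Suc n) t = (\<Sum>\<gamma>\<in>(\<lambda>\<gamma>. 8 * \<gamma>) ` spectrum n. (cmod (ft8 (t - \<gamma>)))\<^sup>2)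
      + (\<Sum>\<gamma>\<in>(\<lambda>\<gamma>. 8 * \<gamma> + 6) ` spectrum n. (cmod (ft8 (t - \<gamma>)))\<^sup>2)"
    unfolding Q_def spectrum.simps by (rule sum.union_disjoint) (auto simp: spectrum_branches_disjoint)
  also have "(\<Sum>\<gamma>\<in>(\<lambda>\<gamma>. 8 * \<gamma>) ` spectrum n. (cmod (ft8 (t - \<gamma>)))\<^sup>2)
      = (\<Sum>\<gamma>\<in>spectrum n. (cmod (ft8 (t - 8 * \<gamma>)))\<^sup>2)"
    by (subst sum.reindex) (auto intro: inj_onI)
  also have "\<dots> = (cos (pi * t / 4))\<^sup>2 * Q n (t / 8)"
    unfolding Q_def sum_distrib_left
  proof (rule sum.cong[OF refl])
    fix \<gamma> assume "\<gamma> \<in> spectrum n"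
    moreover have "(t - 8 * \<gamma>) / 8 = t / 8 - \<gamma>" by (simp add: field_simps)
    ultimately show "(cmod (ft8 (t - 8 * \<gamma>)))\<^sup>2 = (cos (pi * t / 4))\<^sup>2 * (cmod (ft8 (t / 8 - \<gamma>)))\<^sup>2"
      using norm_ft8_rec[of "t - 8 * \<gamma>"] by (simp only: cos_pi_diff_spectrum)
  qed
  also have "(\<Sum>\<gamma>\<in>(\<lambda>\<gamma>. 8 * \<gamma> + 6) ` spectrum n. (cmod (ft8 (t - \<gamma>)))\<^sup>2)
      = (\<Sum>\<gamma>\<in>spectrum n. (cmod (ft8 (t - (8 * \<gamma> + 6))))\<^sup>2)"
    by (subst sum.reindex) (auto intro: inj_onI)
  also have "\<dots> = (sin (pi * t / 4))\<^sup>2 * Q n ((t - 6) / 8)"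
    unfolding Q_def sum_distrib_left
  proof (rule sum.cong[OF refl])
    fix \<gamma> assume "\<gamma> \<in> spectrum n"
    moreover have "(t - (8 * \<gamma> + 6)) / 8 = (t - 6) / 8 - \<gamma>" by (simp add: field_simps)
    ultimately show "(cmod (ft8 (t - (8 * \<gamma> + 6))))\<^sup>2
        = (sin (pi * t / 4))\<^sup>2 * (cmod (ft8 ((t - 6) / 8 - \<gamma>)))\<^sup>2"
      using norm_ft8_rec[of "t - (8 * \<gamma> + 6)"] by (simp only: cos_pi_diff_spectrum)
  qed
  finally show ?thesis .
qed

text \<open>This is Bessel's inequality, obtained here from the convexity of the recursion instead
  of from orthogonality.\<close>

lemma Q_le_1: "Q n t \<le> 1"
proof (induction n arbitrary: t)
  case 0
  show ?case using norm_bernoulli_ft_le[of "1/8" t] by (simp add: Q_0 power_le_one)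
next
  case (Suc n)
  have "Q (Suc n) t \<le> (cos (pi * t / 4))\<^sup>2 * 1 + (sin (pi * t / 4))\<^sup>2 * 1"
    unfolding Q_Suc by (intro add_mono mult_left_mono Suc.IH) auto
  then show ?case by simp
qed

lemma incseq_Q: "incseq (\<lambda>n. Q n t)"
  unfolding Q_def by (intro incseq_SucI sum_mono2 finite_spectrum spectrum_subset_Suc) simp

definition Qlim :: "real \<Rightarrow> real" where
  "Qlim t = lim (\<lambda>n. Q n t)"

lemma Q_tendsto: "(\<lambda>n. Q n t) \<longlonglongrightarrow> Qlim t"
  unfolding Qlim_def convergent_LIMSEQ_iff[symmetric]
  by (metis Bseq_monoseq_convergent Bseq_eq_bounded Q_le_1 Q_nonneg
      incseq_Q monoseq_iff BseqI' abs_of_nonneg real_norm_def)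

lemma Q_le_Qlim: "Q n t \<le> Qlim t"
  by (rule incseq_le[OF incseq_Q Q_tendsto])

lemma Qlim_le_1: "Qlim t \<le> 1"
  by (rule LIMSEQ_le_const2[OF Q_tendsto]) (use Q_le_1 in blast)

lemma Qlim_rec: "Qlim t = (cos (pi * t / 4))\<^sup>2 * Qlim (t / 8) + (sin (pi * t / 4))\<^sup>2 * Qlim ((t - 6) / 8)"
proof (rule LIMSEQ_unique[OF LIMSEQ_Suc[OF Q_tendsto]])
  show "(\<lambda>n. Q (Suc n) t) \<longlonglongrightarrow>
      (cos (pi * t / 4))\<^sup>2 * Qlim (t / 8) + (sin (pi * t / 4))\<^sup>2 * Qlim ((t - 6) / 8)"
    unfolding Q_Suc by (intro tendsto_intros Q_tendsto)
qed

text \<open>With \<open>U\<close> the supremum of \<open>1 - Qlim\<close> on \<open>[-1,1]\<close>, the recursion along the branch \<open>t \<mapsto> t/8\<close>,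
  whose weights multiply up to \<open>\<bar>ft8 t\<bar>\<^sup>2\<close> and along which \<open>1 - Qlim\<close> tends to 0, yields
  \<open>U - (1 - Qlim t) \<ge> U * \<bar>ft8 t\<bar>\<^sup>2\<close>. Since \<open>ft8\<close> is bounded away from 0 on \<open>[-1,1]\<close>, this forces \<open>U = 0\<close>.\<close>

lemma Qlim_eq_1_on_unit:
  assumes "\<bar>t\<bar> \<le> 1"
  shows "Qlim t = 1"
proof -
  define u where "u s = 1 - Qlim s" for s
  define U where "U = (SUP s\<in>{-1..1}. u s)"
  \<comment> \<open>The square of the lower bound for \<open>cmod (ft8 s)\<close> at the ends of
    [-1,1]; it is positive because 2 pi/7 is below pi/2.\<close>
  define c where "c = (cos (2 * pi / 7))\<^sup>2"
  have u_nonneg: "0 \<le> u s" for s using Qlim_le_1 by (simp add: u_def)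
  have u_le: "u s \<le> 1 - (cmod (ft8 s))\<^sup>2" for s
    using Q_le_Qlim[of 0 s] by (simp add: u_def Q_0)
  have u_le_1: "u s \<le> 1" for s
    using u_le[of s] zero_le_power2[of "cmod (ft8 s)"] by linarith
  have "bdd_above (u ` {-1..1})" using u_le_1 by (intro bdd_aboveI2[of _ _ 1])
  then have uU: "u s \<le> U" if "\<bar>s\<bar> \<le> 1" for s
    unfolding U_def using that by (intro cSUP_upper) auto
  have cos_pos: "0 < cos (2 * pi / 7)" by (rule cos_gt_zero) auto
  then have c_pos: "0 < c" by (simp add: c_def)
  have c_le: "c \<le> (cmod (ft8 s))\<^sup>2" if s: "\<bar>s\<bar> \<le> 1" for s
  proof -
    have "cos (2 * pi / 7) \<le> cos (2 * pi * \<bar>s\<bar> / 7)"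
      using s by (intro cos_monotone_0_pi_le) (auto simp: field_simps)
    also have "\<dots> \<le> cmod (ft8 s)" by (rule norm_ft8_ge[OF s])
    finally show ?thesis unfolding c_def using cos_pos by (intro power_mono) auto
  qed
  \<comment> \<open>The weights add up to 1, so the constant \<open>U\<close> passes through the
    recursion.\<close>
  have u_rec: "U - u s = (cos (pi * s / 4))\<^sup>2 * (U - u (s / 8)) + (sin (pi * s / 4))\<^sup>2 * (U - u ((s - 6) / 8))" for s
  proof -
    have "U - 1 = (cos (pi * s / 4))\<^sup>2 * (U - 1) + (sin (pi * s / 4))\<^sup>2 * (U - 1)"
      by (simp flip: distrib_right)
    then show ?thesis unfolding u_def using Qlim_rec[of s] by (simp add: algebra_simps)
  qed
  \<comment> \<open>The dropped sine term is nonnegative: \<open>(s - 6) / 8\<close> lies in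
    [-7/8, -5/8], where \<open>u\<close> is at most \<open>U\<close>.\<close>
  have step: "(cos (pi * s / 4))\<^sup>2 * (U - u (s / 8)) \<le> U - u s" if "\<bar>s\<bar> \<le> 1" for s
    using u_rec[of s] uU[of "(s - 6) / 8"] that by auto
  \<comment> \<open>The product of the cosine weights would be a quotient of two values of
    \<open>ft8\<close>; cross-multiplication avoids the division.\<close>
  have iter: "(cmod (ft8 s))\<^sup>2 * (U - u (s / 8 ^ k)) \<le> (cmod (ft8 (s / 8 ^ k)))\<^sup>2 * (U - u s)"
    if "\<bar>s\<bar> \<le> 1" for s k
    using that
  proof (induction k arbitrary: s)
    case (Suc k)
    have s8: "\<bar>s / 8\<bar> \<le> 1" using Suc.prems by simp
    have "(cmod (ft8 s))\<^sup>2 * (U - u (s / 8 ^ Suc k))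
        = (cos (pi * s / 4))\<^sup>2 * ((cmod (ft8 (s / 8)))\<^sup>2 * (U - u (s / 8 / 8 ^ k)))"
      using norm_ft8_rec[of s] by (simp add: mult_ac)
    also have "\<dots> \<le> (cos (pi * s / 4))\<^sup>2 * ((cmod (ft8 (s / 8 / 8 ^ k)))\<^sup>2 * (U - u (s / 8)))"
      by (intro mult_left_mono Suc.IH s8) simp
    also have "\<dots> = (cmod (ft8 (s / 8 ^ Suc k)))\<^sup>2 * ((cos (pi * s / 4))\<^sup>2 * (U - u (s / 8)))"
      by (simp add: mult_ac)
    also have "\<dots> \<le> (cmod (ft8 (s / 8 ^ Suc k)))\<^sup>2 * (U - u s)"
      by (intro mult_left_mono step Suc.prems) simp
    finally show ?case .
  qed simp
  have lim: "(cmod (ft8 s))\<^sup>2 * U \<le> U - u s" if s: "\<bar>s\<bar> \<le> 1" for s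
  proof -
    have z: "(\<lambda>k. \<bar>s\<bar> / 8 ^ k) \<longlonglongrightarrow> 0"
      using tendsto_mult[OF tendsto_const[of "\<bar>s\<bar>"] LIMSEQ_realpow_zero[of "1 / 8"]]
      by (simp add: power_divide)
    have "(\<lambda>k. cos (2 * pi * (\<bar>s\<bar> / 8 ^ k) / 7)) \<longlonglongrightarrow> cos (2 * pi * 0 / 7)"
      by (intro tendsto_intros z) simp
    then have z: "(\<lambda>k. cos (2 * pi * (\<bar>s\<bar> / 8 ^ k) / 7)) \<longlonglongrightarrow> 1" by simp
    have "(\<lambda>k. cmod (ft8 (s / 8 ^ k))) \<longlonglongrightarrow> 1"
    \<comment> \<open>The cosine lower bound and the upper bound 1 take the place of continuity of
      \<open>ft8\<close> at 0.\<close>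
    proof (rule tendsto_sandwich[OF _ _ z tendsto_const])
      have "cos (2 * pi * (\<bar>s\<bar> / 8 ^ k) / 7) \<le> cmod (ft8 (s / 8 ^ k))" for k
      proof -
        have "\<bar>s / 8 ^ k\<bar> \<le> 1"
          using s by (simp add: divide_le_eq order_trans[OF s])
        then show ?thesis using norm_ft8_ge[of "s / 8 ^ k"] by simp
      qed
      then show "\<forall>\<^sub>F k in sequentially. cos (2 * pi * (\<bar>s\<bar> / 8 ^ k) / 7) \<le> cmod (ft8 (s / 8 ^ k))"
        by simp
    qed (simp add: norm_bernoulli_ft_le)
    then have f: "(\<lambda>k. (cmod (ft8 (s / 8 ^ k)))\<^sup>2) \<longlonglongrightarrow> 1\<^sup>2"
      by (rule tendsto_power)
    have "(\<lambda>k. u (s / 8 ^ k)) \<longlonglongrightarrow> 0"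
    proof (rule tendsto_sandwich[OF _ _ tendsto_const])
      show "(\<lambda>k. 1 - (cmod (ft8 (s / 8 ^ k)))\<^sup>2) \<longlonglongrightarrow> 0"
        using tendsto_diff[OF tendsto_const f, of 1] by simp
    qed (use u_nonneg u_le in auto)
    then have "(\<lambda>k. (cmod (ft8 s))\<^sup>2 * (U - u (s / 8 ^ k))) \<longlonglongrightarrow> (cmod (ft8 s))\<^sup>2 * (U - 0)"
      by (intro tendsto_intros)
    moreover have "(\<lambda>k. (cmod (ft8 (s / 8 ^ k)))\<^sup>2 * (U - u s)) \<longlonglongrightarrow> 1\<^sup>2 * (U - u s)"
      by (intro tendsto_intros f)
    ultimately show ?thesis
      using LIMSEQ_le[of _ "(cmod (ft8 s))\<^sup>2 * (U - 0)" _ "1\<^sup>2 * (U - u s)"] iter[OF s] by simp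
  qed
  have U_nonneg: "0 \<le> U" using uU[of 0] u_nonneg[of 0] by simp
  have "u s \<le> (1 - c) * U" if "\<bar>s\<bar> \<le> 1" for s
    using lim[OF that] mult_right_mono[OF c_le[OF that] U_nonneg] by (simp add: algebra_simps)
  then have "U \<le> (1 - c) * U"
    unfolding U_def by (intro cSUP_least) (auto simp flip: U_def)
  then have "c * U \<le> 0" by (simp add: algebra_simps)
  then have "U \<le> 0" using c_pos by (simp add: mult_le_0_iff)
  then have "u t = 0" using uU[OF assms] u_nonneg[of t] by linarith
  then show ?thesis by (simp add: u_def)
qed

text \<open>Both branches send radius n + 2 into radius n + 1, since (n + 2 + 6)/8 = n/8 + 1.
  Induction on the radius thus extends the value from [-1,1] to the line.\<close>

lemma Qlim_eq_1: "Qlim t = 1"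
proof -
  have "Qlim t = 1" if "\<bar>t\<bar> \<le> real n + 1" for n t
    using that
  proof (induction n arbitrary: t)
    case 0
    then show ?case by (intro Qlim_eq_1_on_unit) simp
  next
    case (Suc n)
    have "Qlim (t / 8) = 1" "Qlim ((t - 6) / 8) = 1"
      using Suc.prems by (auto intro!: Suc.IH)
    then show ?case by (subst Qlim_rec) simp
  qed
  moreover obtain n where "\<bar>t\<bar> \<le> real n" using real_arch_simple by blast
  ultimately show ?thesis by (metis add.commute add_increasing zero_le_one)
qed

subsection \<open>Closed spans in \<open>L\<^sup>2\<close>\<close>

lemma norm_add_squared_le: "(norm (a + b :: 'a :: real_normed_vector))\<^sup>2 \<le> 2 * (norm a)\<^sup>2 + 2 * (norm b)\<^sup>2"
proof -
  have "(norm (a + b))\<^sup>2 \<le> (norm a + norm b)\<^sup>2"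
    by (intro power_mono norm_triangle_ineq) simp
  also have "\<dots> \<le> 2 * (norm a)\<^sup>2 + 2 * (norm b)\<^sup>2"
    using sum_squares_bound[of "norm a" "norm b"] by (simp add: power2_sum)
  finally show ?thesis .
qed

lemma L2_measurable: "f \<in> L2 M \<Longrightarrow> f \<in> borel_measurable M"
  by (simp add: L2_def)

lemma L2_integrable: "f \<in> L2 M \<Longrightarrow> integrable M (\<lambda>x. (cmod (f x))\<^sup>2)"
  by (simp add: L2_def)

lemma L2_add:
  assumes "f \<in> L2 M" "g \<in> L2 M"
  shows "(\<lambda>x. f x + g x) \<in> L2 M"
proof -
  note [measurable] = assms[THEN L2_measurable]
  have "integrable M (\<lambda>x. (cmod (f x + g x))\<^sup>2)"
  proof (rule Bochner_Integration.integrable_bound)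
    show "integrable M (\<lambda>x. 2 * (cmod (f x))\<^sup>2 + 2 * (cmod (g x))\<^sup>2)"
      using assms by (simp add: L2_def)
    show "AE x in M. norm ((cmod (f x + g x))\<^sup>2) \<le> norm (2 * (cmod (f x))\<^sup>2 + 2 * (cmod (g x))\<^sup>2)"
      using norm_add_squared_le by (intro AE_I2) (simp add: abs_of_nonneg)
  qed measurable
  then show ?thesis by (simp add: L2_def)
qed

lemma L2_cmult:
  assumes "f \<in> L2 M"
  shows "(\<lambda>x. c * f x) \<in> L2 M"
  using assms by (auto simp: L2_def norm_mult power_mult_distrib)

lemma L2_diff:
  assumes "f \<in> L2 M" "g \<in> L2 M"
  shows "(\<lambda>x. f x - g x) \<in> L2 M"
  using L2_add[OF assms(1) L2_cmult[OF assms(2), of "-1"]] by simp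

lemma L2_sum:
  assumes "\<And>i. i \<in> I \<Longrightarrow> f i \<in> L2 M"
  shows "(\<lambda>x. \<Sum>i\<in>I. f i x) \<in> L2 M"
  using assms
proof (induction I rule: infinite_finite_induct)
  case (insert i I)
  then show ?case using L2_add[of "f i" M "\<lambda>x. \<Sum>i\<in>I. f i x"] by simp
qed (simp_all add: L2_def)

lemma (in finite_measure) L2_bounded:
  assumes "f \<in> borel_measurable M" "AE x in M. cmod (f x) \<le> C"
  shows "f \<in> L2 M"
proof -
  note [measurable] = assms(1)
  have "integrable M (\<lambda>x. (cmod (f x))\<^sup>2)"
  proof (rule integrable_const_bound)
    show "AE x in M. norm ((cmod (f x))\<^sup>2) \<le> C\<^sup>2"
      using assms(2) by eventually_elim (simp add: power_mono)
  qed measurable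
  then show ?thesis by (simp add: L2_def)
qed

text \<open>Working with the squared distance avoids roots and the Minkowski inequality; the price
  is the factor 2 in \<open>sqdist_triangle\<close>.\<close>

definition sqdist :: "'a measure \<Rightarrow> ('a \<Rightarrow> complex) \<Rightarrow> ('a \<Rightarrow> complex) \<Rightarrow> real" where
  "sqdist M f g = (\<integral>x. (cmod (f x - g x))\<^sup>2 \<partial>M)"

lemma sqdist_nonneg: "0 \<le> sqdist M f g"
  unfolding sqdist_def by simp

lemma sqdist_triangle:
  assumes "f \<in> L2 M" "g \<in> L2 M" "h \<in> L2 M"
  shows "sqdist M f h \<le> 2 * sqdist M f g + 2 * sqdist M g h"
proof -
  note int = L2_integrable[OF L2_diff]
  have "sqdist M f h \<le> (\<integral>x. 2 * (cmod (f x - g x))\<^sup>2 + 2 * (cmod (g x - h x))\<^sup>2 \<partial>M)"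
    unfolding sqdist_def
  proof (rule integral_mono)
    show "(cmod (f x - h x))\<^sup>2 \<le> 2 * (cmod (f x - g x))\<^sup>2 + 2 * (cmod (g x - h x))\<^sup>2" for x
      using norm_add_squared_le[of "f x - g x" "g x - h x"] by simp
  qed (intro Bochner_Integration.integrable_add integrable_mult_right int assms)+
  also have "\<dots> = 2 * sqdist M f g + 2 * sqdist M g h"
    unfolding sqdist_def
    by (simp add: Bochner_Integration.integral_add integrable_mult_right int assms)
  finally show ?thesis .
qed

section \<open>Finite linear spans\<close>

text \<open>Coefficients are indexed by the functions themselves, which matches the form required by
  \<open>orthonormal_basis\<close>.\<close>

definition fspan :: "('a \<Rightarrow> complex) set \<Rightarrow> ('a \<Rightarrow> complex) set" where
  "fspan B = {\<lambda>x. \<Sum>g\<in>F. c g * g x | F c. finite F \<and> F \<subseteq> B}"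

lemma fspanI: "finite F \<Longrightarrow> F \<subseteq> B \<Longrightarrow> (\<lambda>x. \<Sum>g\<in>F. c g * g x) \<in> fspan B"
  unfolding fspan_def by blast

lemma fspan_zero: "(\<lambda>x. 0) \<in> fspan B"
  using fspanI[of "{}" B] by simp

lemma fspan_base: "g \<in> B \<Longrightarrow> g \<in> fspan B"
  using fspanI[of "{g}" B "\<lambda>_. 1"] by simp

lemma fspan_cmult:
  assumes "f \<in> fspan B"
  shows "(\<lambda>x. a * f x) \<in> fspan B"
proof -
  obtain F c where F: "finite F" "F \<subseteq> B" "f = (\<lambda>x. \<Sum>g\<in>F. c g * g x)"
    using assms unfolding fspan_def by blast
  show ?thesis using fspanI[OF F(1,2), of "\<lambda>g. a * c g"]
    by (simp add: F(3) sum_distrib_left mult.assoc)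
qed

lemma fspan_add:
  assumes "f \<in> fspan B" "h \<in> fspan B"
  shows "(\<lambda>x. f x + h x) \<in> fspan B"
proof -
  obtain F c where F: "finite F" "F \<subseteq> B" "f = (\<lambda>x. \<Sum>g\<in>F. c g * g x)"
    using assms(1) unfolding fspan_def by blast
  obtain G d where G: "finite G" "G \<subseteq> B" "h = (\<lambda>x. \<Sum>g\<in>G. d g * g x)"
    using assms(2) unfolding fspan_def by blast
  \<comment> \<open>Each coefficient family is extended by 0, so that coefficients add up where
    \<open>F\<close> and \<open>G\<close> overlap.\<close>
  define e where "e g = (if g \<in> F then c g else 0) + (if g \<in> G then d g else 0)" for g
  have "(\<Sum>g\<in>F \<union> G. e g * g x) = f x + h x" for x
  proof -
    have "(\<Sum>g\<in>F \<union> G. e g * g x)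
        = (\<Sum>g\<in>F \<union> G. if g \<in> F then c g * g x else 0) + (\<Sum>g\<in>F \<union> G. if g \<in> G then d g * g x else 0)"
      unfolding sum.distrib[symmetric] by (intro sum.cong) (auto simp: e_def distrib_right)
    also have "(\<Sum>g\<in>F \<union> G. if g \<in> F then c g * g x else 0) = f x"
      unfolding F(3) using F(1) G(1) by (intro sum.mono_neutral_cong_right) auto
    also have "(\<Sum>g\<in>F \<union> G. if g \<in> G then d g * g x else 0) = h x"
      unfolding G(3) using F(1) G(1) by (intro sum.mono_neutral_cong_right) auto
    finally show ?thesis .
  qed
  then show ?thesis using fspanI[of "F \<union> G" B e] F G by simp
qed

lemma fspan_sum:
  assumes "\<And>i. i \<in> I \<Longrightarrow> f i \<in> fspan B"
  shows "(\<lambda>x. \<Sum>i\<in>I. f i x) \<in> fspan B"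
  using assms
proof (induction I rule: infinite_finite_induct)
  case (insert i I)
  then show ?case using fspan_add[of "f i" B "\<lambda>x. \<Sum>i\<in>I. f i x"] by simp
qed (simp_all add: fspan_zero)

text \<open>A generating set closed under products spans an algebra, as Stone-Weierstrass
  requires.\<close>

lemma fspan_mult:
  assumes B: "\<And>g h. g \<in> B \<Longrightarrow> h \<in> B \<Longrightarrow> (\<lambda>x. g x * h x) \<in> B"
    and "f \<in> fspan B" "h \<in> fspan B"
  shows "(\<lambda>x. f x * h x) \<in> fspan B"
proof -
  obtain F c where F: "F \<subseteq> B" "f = (\<lambda>x. \<Sum>g\<in>F. c g * g x)"
    using assms(2) unfolding fspan_def by blast
  obtain G d where G: "G \<subseteq> B" "h = (\<lambda>x. \<Sum>g\<in>G. d g * g x)"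
    using assms(3) unfolding fspan_def by blast
  have "(\<lambda>x. \<Sum>g\<in>F. \<Sum>k\<in>G. (c g * d k) * (g x * k x)) \<in> fspan B"
    using F(1) G(1) by (intro fspan_sum fspan_cmult fspan_base B) auto
  moreover have "(\<lambda>x. \<Sum>g\<in>F. \<Sum>k\<in>G. (c g * d k) * (g x * k x)) = (\<lambda>x. f x * h x)"
    by (simp add: F(2) G(2) sum_product mult_ac)
  ultimately show ?thesis by simp
qed

lemma fspan_L2:
  assumes "B \<subseteq> L2 M" "f \<in> fspan B"
  shows "f \<in> L2 M"
proof -
  obtain F c where "F \<subseteq> B" "f = (\<lambda>x. \<Sum>g\<in>F. c g * g x)"
    using assms(2) unfolding fspan_def by blast
  then show ?thesis using assms(1) by (auto intro!: L2_sum L2_cmult)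
qed

section \<open>Closures of spans\<close>

definition closed_span :: "'a measure \<Rightarrow> ('a \<Rightarrow> complex) set \<Rightarrow> ('a \<Rightarrow> complex) set" where
  "closed_span M B = {f \<in> L2 M. \<forall>\<epsilon>>0. \<exists>h\<in>fspan B. sqdist M f h < \<epsilon>}"

lemma closed_span_L2: "f \<in> closed_span M B \<Longrightarrow> f \<in> L2 M"
  by (simp add: closed_span_def)

lemma closed_spanI:
  assumes "f \<in> L2 M" "\<And>\<epsilon>. \<epsilon> > 0 \<Longrightarrow> \<exists>h\<in>fspan B. sqdist M f h < \<epsilon>"
  shows "f \<in> closed_span M B"
  using assms by (simp add: closed_span_def)

lemma closed_spanE:
  assumes "f \<in> closed_span M B" "0 < \<epsilon>"
  obtains h where "h \<in> fspan B" "sqdist M f h < \<epsilon>"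
  using assms unfolding closed_span_def by blast

lemma orthonormal_basisI:
  assumes "orthonormal_set M B" "L2 M \<subseteq> closed_span M B"
  shows "orthonormal_basis M B"
  unfolding orthonormal_basis_def
proof (intro conjI ballI allI impI)
  fix f and \<epsilon> :: real assume f: "f \<in> L2 M" and \<epsilon>: "0 < \<epsilon>"
  then have "f \<in> closed_span M B" using assms(2) by blast
  then obtain h where h: "h \<in> fspan B" "sqdist M f h < \<epsilon>\<^sup>2"
    using \<epsilon> by (auto elim: closed_spanE[of _ _ _ "\<epsilon>\<^sup>2"])
  then obtain F c where F: "finite F" "F \<subseteq> B" "h = (\<lambda>x. \<Sum>g\<in>F. c g * g x)"
    unfolding fspan_def by blast
  have "L2_norm M (\<lambda>x. f x - (\<Sum>g\<in>F. c g * g x)) = sqrt (sqdist M f h)"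
    by (simp add: L2_norm_def sqdist_def F(3))
  also have "\<dots> < sqrt (\<epsilon>\<^sup>2)" using h(2) by (rule real_sqrt_less_mono)
  finally show "\<exists>F c. finite F \<and> F \<subseteq> B \<and> L2_norm M (\<lambda>x. f x - (\<Sum>g\<in>F. c g * g x)) < \<epsilon>"
    using F \<epsilon> by auto
qed (rule assms(1))

text \<open>Taking closures twice gives nothing new; two errors below \<open>\<epsilon> / 4\<close>
  balance the factors 2 of \<open>sqdist_triangle\<close>.\<close>

lemma closed_span_closed:
  assumes B: "B \<subseteq> L2 M" and f: "f \<in> L2 M"
    and g: "\<And>\<epsilon>. \<epsilon> > 0 \<Longrightarrow> \<exists>g\<in>closed_span M B. sqdist M f g < \<epsilon>"
  shows "f \<in> closed_span M B"
proof (rule closed_spanI[OF f])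
  fix \<epsilon> :: real assume \<epsilon>: "0 < \<epsilon>"
  obtain g where g: "g \<in> closed_span M B" "sqdist M f g < \<epsilon> / 4"
    using g[of "\<epsilon> / 4"] \<epsilon> by auto
  obtain h where h: "h \<in> fspan B" "sqdist M g h < \<epsilon> / 4"
    using closed_spanE[OF g(1), of "\<epsilon> / 4"] \<epsilon> by auto
  have "sqdist M f h \<le> 2 * sqdist M f g + 2 * sqdist M g h"
    using f g(1) h(1) B by (intro sqdist_triangle) (auto intro: closed_span_L2 fspan_L2)
  with g(2) h(2) show "\<exists>h\<in>fspan B. sqdist M f h < \<epsilon>" using h(1) by force
qed

lemma closed_span_add:
  assumes B: "B \<subseteq> L2 M" and f: "f \<in> closed_span M B" "g \<in> closed_span M B"
  shows "(\<lambda>x. f x + g x) \<in> closed_span M B"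
proof (rule closed_spanI)
  show "(\<lambda>x. f x + g x) \<in> L2 M" using f by (intro L2_add closed_span_L2)
  fix \<epsilon> :: real assume \<epsilon>: "0 < \<epsilon>"
  obtain h where h: "h \<in> fspan B" "sqdist M f h < \<epsilon> / 4"
    using closed_spanE[OF f(1), of "\<epsilon> / 4"] \<epsilon> by auto
  obtain k where k: "k \<in> fspan B" "sqdist M g k < \<epsilon> / 4"
    using closed_spanE[OF f(2), of "\<epsilon> / 4"] \<epsilon> by auto
  have L: "f \<in> L2 M" "g \<in> L2 M" "h \<in> L2 M" "k \<in> L2 M"
    using f h(1) k(1) B by (auto intro: closed_span_L2 fspan_L2)
  have "sqdist M (\<lambda>x. f x + g x) (\<lambda>x. h x + k x)
      \<le> 2 * sqdist M (\<lambda>x. f x + g x) (\<lambda>x. h x + g x) + 2 * sqdist M (\<lambda>x. h x + g x) (\<lambda>x. h x + k x)"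
    using L by (intro sqdist_triangle L2_add)
  then have "sqdist M (\<lambda>x. f x + g x) (\<lambda>x. h x + k x) < \<epsilon>"
    using h(2) k(2) by (simp add: sqdist_def)
  then show "\<exists>h\<in>fspan B. sqdist M (\<lambda>x. f x + g x) h < \<epsilon>"
    using fspan_add[OF h(1) k(1)] by blast
qed

lemma closed_span_cmult:
  assumes f: "f \<in> closed_span M B"
  shows "(\<lambda>x. c * f x) \<in> closed_span M B"
proof (rule closed_spanI)
  show "(\<lambda>x. c * f x) \<in> L2 M" using f by (intro L2_cmult closed_span_L2)
  fix \<epsilon> :: real assume \<epsilon>: "0 < \<epsilon>"
  \<comment> \<open>The added 1 keeps the divisor positive when \<open>c\<close> is 0.\<close>
  define K where "K = (cmod c)\<^sup>2 + 1"
  have K: "0 < K" by (simp add: K_def add_nonneg_pos)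
  obtain h where h: "h \<in> fspan B" "sqdist M f h < \<epsilon> / K"
    using closed_spanE[OF f, of "\<epsilon> / K"] \<epsilon> K by auto
  have "sqdist M (\<lambda>x. c * f x) (\<lambda>x. c * h x) = (cmod c)\<^sup>2 * sqdist M f h"
    unfolding sqdist_def by (simp flip: right_diff_distrib add: norm_mult power_mult_distrib)
  also have "\<dots> \<le> K * sqdist M f h"
    by (intro mult_right_mono sqdist_nonneg) (simp add: K_def)
  also have "\<dots> < \<epsilon>" using h(2) K by (simp add: field_simps)
  finally show "\<exists>h\<in>fspan B. sqdist M (\<lambda>x. c * f x) h < \<epsilon>"
    using fspan_cmult[OF h(1)] by blast
qed

lemma closed_span_sum:
  assumes "B \<subseteq> L2 M" "\<And>i. i \<in> I \<Longrightarrow> f i \<in> closed_span M B"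
  shows "(\<lambda>x. \<Sum>i\<in>I. f i x) \<in> closed_span M B"
proof -
  have zero: "(\<lambda>x. 0) \<in> closed_span M B"
    by (rule closed_spanI) (auto simp: L2_def sqdist_def intro!: bexI[OF _ fspan_zero])
  show ?thesis
    using assms(2)
  proof (induction I rule: infinite_finite_induct)
    case (insert i I)
    then show ?case
      using closed_span_add[OF assms(1), of "f i" "\<lambda>x. \<Sum>i\<in>I. f i x"] by simp
  qed (simp_all add: zero)
qed

text \<open>Dominated convergence, applied to the squared distances with majorant the square of
  \<open>w\<close>, turns pointwise limits into limits in L2.\<close>

lemma closed_span_dominated:
  assumes B: "B \<subseteq> L2 M" and f: "f \<in> L2 M" and s: "\<And>n. s n \<in> closed_span M B"
    and w: "integrable M (\<lambda>x. (w x)\<^sup>2)"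
    and lim: "AE x in M. (\<lambda>n. s n x) \<longlonglongrightarrow> f x"
    and le: "\<And>n. AE x in M. cmod (s n x - f x) \<le> w x"
  shows "f \<in> closed_span M B"
proof (rule closed_span_closed[OF B f])
  fix \<epsilon> :: real assume \<epsilon>: "0 < \<epsilon>"
  note [measurable] = L2_measurable[OF f] L2_measurable[OF closed_span_L2[OF s]]
  have "(\<lambda>n. sqdist M f (s n)) \<longlonglongrightarrow> (\<integral>x. 0 \<partial>M)"
    unfolding sqdist_def
  proof (rule integral_dominated_convergence[OF _ _ w])
    show "AE x in M. (\<lambda>n. (cmod (f x - s n x))\<^sup>2) \<longlonglongrightarrow> 0"
      using lim
    proof eventually_elim
      fix x assume "(\<lambda>n. s n x) \<longlonglongrightarrow> f x"
      then have "(\<lambda>n. (cmod (f x - s n x))\<^sup>2) \<longlonglongrightarrow> (cmod (f x - f x))\<^sup>2"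
        by (intro tendsto_intros)
      then show "(\<lambda>n. (cmod (f x - s n x))\<^sup>2) \<longlonglongrightarrow> 0" by simp
    qed
    show "AE x in M. norm ((cmod (f x - s n x))\<^sup>2) \<le> (w x)\<^sup>2" for n
      using le[of n] by eventually_elim (simp add: power_mono norm_minus_commute)
  qed measurable
  then have "\<forall>\<^sub>F n in sequentially. sqdist M f (s n) < \<epsilon>"
    using \<epsilon> by (intro order_tendstoD(2)[of _ 0]) auto
  then obtain n where "sqdist M f (s n) < \<epsilon>"
    by (auto simp: eventually_sequentially)
  then show "\<exists>g\<in>closed_span M B. sqdist M f g < \<epsilon>" using s by blast
qed

section \<open>Density of the span of all exponentials\<close>

text \<open>Stone-Weierstrass is applied to the real functions whose complex embedding is a
  trigonometric sum. They form an algebra because a product of exponentials is an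
  exponential.\<close>

lemma ex_trig_approx:
  fixes h :: "real \<Rightarrow> real"
  assumes h: "continuous_on {-1..1} h" and \<epsilon>: "0 < \<epsilon>"
  shows "\<exists>r. continuous_on UNIV r \<and> (\<lambda>x. of_real (r x)) \<in> fspan (range expo) \<and> (\<forall>x\<in>{-1..1}. \<bar>h x - r x\<bar> < \<epsilon>)"
proof -
  define R where "R = {r :: real \<Rightarrow> real. continuous_on UNIV r \<and> (\<lambda>x. of_real (r x)) \<in> fspan (range expo)}"
  have mult: "(\<lambda>x. g x * h x) \<in> range expo" if gh: "g \<in> range expo" "h \<in> range expo" for g h
  proof -
    obtain s t where "g = expo s" "h = expo t" using gh by blast
    then have "(\<lambda>x. g x * h x) = expo (s + t)" by (simp add: expo_mult fun_eq_iff)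
    then show ?thesis by blast
  qed
  interpret function_ring_on R "{-1..1}"
  proof
    show "compact {-1..1 :: real}" by simp
    show "continuous_on {-1..1} f" if "f \<in> R" for f
      using that unfolding R_def by (auto intro: continuous_on_subset)
    show "(\<lambda>x. f x + g x) \<in> R" if "f \<in> R" "g \<in> R" for f g
      using that fspan_add[of "\<lambda>x. of_real (f x)" "range expo" "\<lambda>x. of_real (g x)"]
      by (simp add: R_def continuous_on_add)
    show "(\<lambda>x. f x * g x) \<in> R" if fg: "f \<in> R" "g \<in> R" for f g
    proof -
      have "(\<lambda>x. complex_of_real (f x) * of_real (g x)) \<in> fspan (range expo)"
        by (rule fspan_mult) (use mult fg in \<open>simp_all add: R_def\<close>)
      then show ?thesis using fg by (simp add: R_def continuous_on_mult)
    qed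
    show "(\<lambda>_. c) \<in> R" for c
      using fspan_cmult[OF fspan_base[of "expo 0" "range expo"], of "of_real c"]
      by (simp add: R_def)
    show "\<exists>f\<in>R. f x \<noteq> f y" if xy: "x \<in> {-1..1}" "y \<in> {-1..1}" "x \<noteq> y" for x y
    proof (rule bexI)
      \<comment> \<open>This single function is injective on [-1,1] and so separates all pairs of
        points. By Euler's formula it uses the frequencies 1/4 and -1/4.\<close>
      show "sin (pi / 2 * x) \<noteq> sin (pi / 2 * y)"
      proof
        assume eq: "sin (pi / 2 * x) = sin (pi / 2 * y)"
        have bd: "- (pi / 2) \<le> pi / 2 * z" "pi / 2 * z \<le> pi / 2" if "z \<in> {-1..1}" for z
          using mult_left_mono[of "-1" z "pi / 2"] mult_left_mono[of z 1 "pi / 2"] that by auto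
        have "pi / 2 * x = pi / 2 * y"
          by (rule sin_inj_pi[OF bd(1)[OF xy(1)] bd(2)[OF xy(1)] bd(1)[OF xy(2)] bd(2)[OF xy(2)] eq])
        then show False using xy(3) by simp
      qed
      have "(\<lambda>x. 1 / (2 * \<i>) * expo (1/4) x + - 1 / (2 * \<i>) * expo (- 1/4) x) \<in> fspan (range expo)"
        by (intro fspan_add fspan_cmult fspan_base) auto
      moreover have "(\<lambda>x. 1 / (2 * \<i>) * expo (1/4) x + - 1 / (2 * \<i>) * expo (- 1/4) x)
          = (\<lambda>x. complex_of_real (sin (pi / 2 * x)))"
        by (auto simp: fun_eq_iff expo_eq_cis complex_eq_iff)
      ultimately show "(\<lambda>x. sin (pi / 2 * x)) \<in> R"
        unfolding R_def by (simp add: continuous_intros)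
    qed
  qed
  show ?thesis using Stone_Weierstrass_basic[OF h \<epsilon>] by (auto simp: R_def)
qed

text \<open>The closed span successively absorbs trigonometric sums, continuous real functions,
  indicators of compact sets, indicators of Borel sets, simple functions, and finally all of
  \<open>L2 M\<close>.\<close>

lemma L2_subset_closed_span:
  assumes M: "prob_space M" and sets: "sets M = sets borel"
    and supp: "AE x in M. \<bar>x\<bar> \<le> 1"
    and B: "B \<subseteq> L2 M" and expo: "\<And>t. expo t \<in> closed_span M B"
  shows "L2 M \<subseteq> closed_span M B"
proof -
  interpret prob_space M by (rule M)
  note [measurable_cong] = sets
  have span: "f \<in> closed_span M B" if f: "f \<in> fspan (range expo)" for f
  proof -
    obtain F c where F: "F \<subseteq> range expo" "f = (\<lambda>x. \<Sum>g\<in>F. c g * g x)"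
      using f unfolding fspan_def by blast
    have "g \<in> closed_span M B" if "g \<in> F" for g
      using F(1) that expo by blast
    then show ?thesis unfolding F(2) by (intro closed_span_sum[OF B] closed_span_cmult)
  qed
  have cont: "(\<lambda>x. of_real (h x)) \<in> closed_span M B"
    if h: "continuous_on UNIV h" for h :: "real \<Rightarrow> real"
  proof (rule closed_span_closed[OF B])
    have [measurable]: "h \<in> borel_measurable borel"
      by (rule borel_measurable_continuous_onI[OF h])
    have h1: "continuous_on {-1..1} h" using h by (rule continuous_on_subset) simp
    have "compact (h ` {-1..1})" by (rule compact_continuous_image[OF h1]) simp
    then obtain C where C: "\<forall>x\<in>{-1..1}. \<bar>h x\<bar> \<le> C"
      using compact_imp_bounded[of "h ` {-1..1}"] by (auto simp: bounded_iff)
    show "(\<lambda>x. complex_of_real (h x)) \<in> L2 M"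
    proof (rule L2_bounded)
      show "AE x in M. cmod (of_real (h x)) \<le> C"
        using supp by eventually_elim (use C in \<open>auto simp: abs_le_iff\<close>)
    qed measurable
    fix \<epsilon> :: real assume \<epsilon>: "0 < \<epsilon>"
    then obtain r where r: "continuous_on UNIV r" "(\<lambda>x. of_real (r x)) \<in> fspan (range expo)"
        "\<forall>x\<in>{-1..1}. \<bar>h x - r x\<bar> < sqrt (\<epsilon> / 2)"
      using ex_trig_approx[OF h1, of "sqrt (\<epsilon> / 2)"] by auto
    have [measurable]: "r \<in> borel_measurable borel"
      by (rule borel_measurable_continuous_onI[OF r(1)])
    have le: "AE x in M. (cmod (of_real (h x) - of_real (r x)))\<^sup>2 \<le> \<epsilon> / 2"
      using supp
    proof eventually_elim
      fix x :: real assume "\<bar>x\<bar> \<le> 1"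
      then have "x \<in> {-1..1}" by auto
      then have "\<bar>h x - r x\<bar> \<le> sqrt (\<epsilon> / 2)" using r(3) less_imp_le by blast
      then have "\<bar>h x - r x\<bar>\<^sup>2 \<le> (sqrt (\<epsilon> / 2))\<^sup>2" by (intro power_mono) auto
      then show "(cmod (of_real (h x) - of_real (r x)))\<^sup>2 \<le> \<epsilon> / 2"
        using \<epsilon> by (simp flip: of_real_diff)
    qed
    have "sqdist M (\<lambda>x. of_real (h x)) (\<lambda>x. of_real (r x)) \<le> (\<integral>x. \<epsilon> / 2 \<partial>M)"
      unfolding sqdist_def
    proof (rule integral_mono_AE[OF _ _ le])
      show "integrable M (\<lambda>x. (cmod (of_real (h x) - of_real (r x)))\<^sup>2)"
        using le by (intro integrable_const_bound[of _ "\<epsilon> / 2"]) auto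
    qed simp
    also have "\<dots> < \<epsilon>" using \<epsilon> prob_space by simp
    finally show "\<exists>g\<in>closed_span M B. sqdist M (\<lambda>x. of_real (h x)) g < \<epsilon>"
      using span[OF r(2)] by blast
  qed
  have ind_L2: "(\<lambda>x. of_real (indicator A x)) \<in> L2 M" if "A \<in> sets borel" for A :: "real set"
    using that by (intro L2_bounded[of _ 1]) (auto simp: indicator_def)
  have comp: "(\<lambda>x. of_real (indicator K x)) \<in> closed_span M B" if K: "compact K" for K :: "real set"
  \<comment> \<open>The distance to the empty set is 0 by convention, so the functions
    \<open>b\<close> below would not converge to its indicator.\<close>
  proof (cases "K = {}")
    case True
    then show ?thesis using cont[of "\<lambda>_. 0"] by simp
  next
    case False
    have [measurable]: "K \<in> sets borel" using K by (simp add: borel_compact)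
    \<comment> \<open>Equal to 1 on \<open>K\<close> and strictly between 0 and 1 outside, so its
      powers decrease to the indicator of \<open>K\<close>.\<close>
    define b where "b x = exp (- infdist x K)" for x
    have b: "0 < b x" "b x \<le> 1" for x by (auto simp: b_def infdist_nonneg)
    show ?thesis
    proof (rule closed_span_dominated[OF B ind_L2, where w = "\<lambda>_. 1"])
      show "(\<lambda>x. of_real (b x ^ n)) \<in> closed_span M B" for n
        unfolding b_def by (intro cont continuous_intros)
      have "(\<lambda>n. b x ^ n) \<longlonglongrightarrow> indicator K x" for x
      proof (cases "x \<in> K")
        case True
        then show ?thesis by (simp add: b_def)
      next
        case False
        then have "0 < infdist x K"
          using K \<open>K \<noteq> {}\<close> infdist_pos_not_in_closed[of K x] by (auto simp: compact_imp_closed)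
        then have "b x < 1" by (simp add: b_def)
        then show ?thesis using b[of x] False by (simp add: LIMSEQ_realpow_zero)
      qed
      then show "AE x in M. (\<lambda>n. complex_of_real (b x ^ n)) \<longlonglongrightarrow> of_real (indicator K x)"
        by (intro AE_I2 tendsto_of_real)
      have "\<bar>b x ^ n - indicator K x\<bar> \<le> 1" for x n
        using b[of x] power_le_one[of "b x" n] zero_le_power[of "b x" n]
        by (auto simp: indicator_def)
      then show "AE x in M. cmod (of_real (b x ^ n) - of_real (indicator K x)) \<le> 1" for n
        by (intro AE_I2) (simp flip: of_real_diff del: of_real_power)
    qed auto
  qed
  have ind: "(\<lambda>x. of_real (indicator A x)) \<in> closed_span M B" if A: "A \<in> sets borel" for A :: "real set"
  proof (rule closed_span_closed[OF B ind_L2[OF A]])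
    fix \<epsilon> :: real assume \<epsilon>: "0 < \<epsilon>"
    note [measurable] = A
    have "\<exists>K. K \<subseteq> A \<and> compact K \<and> measure M A - \<epsilon> < measure M K"
    \<comment> \<open>In \<open>ennreal\<close> a negative number becomes 0, and the strict
      inequality needed for inner regularity could fail on a null set.\<close>
    proof (cases "measure M A - \<epsilon> < 0")
      case True
      then show ?thesis by (intro exI[of _ "{}"]) simp
    next
      case False
      have "ennreal (measure M A - \<epsilon>) < emeasure M A"
        using False \<epsilon> by (simp add: emeasure_eq_measure ennreal_less_iff)
      also have "emeasure M A = (SUP K\<in>{K. K \<subseteq> A \<and> compact K}. emeasure M K)"
        using sets A by (intro inner_regular) auto
      finally obtain K where "K \<subseteq> A" "compact K" "ennreal (measure M A - \<epsilon>) < emeasure M K"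
        by (auto simp: less_SUP_iff)
      then show ?thesis using False by (auto simp: emeasure_eq_measure ennreal_less_iff)
    qed
    then obtain K where K: "K \<subseteq> A" "compact K" "measure M A - \<epsilon> < measure M K" by blast
    have [measurable]: "K \<in> sets borel" using K by (simp add: borel_compact)
    have "(cmod (of_real (indicator A x) - of_real (indicator K x)))\<^sup>2 = indicator (A - K) x" for x
      using K(1) by (auto simp: indicator_def)
    then have "sqdist M (\<lambda>x. of_real (indicator A x)) (\<lambda>x. of_real (indicator K x)) = measure M (A - K)"
      unfolding sqdist_def using sets_eq_imp_space_eq[OF sets] by simp
    also have "\<dots> < \<epsilon>"
      using K finite_measure_Diff[of A K] sets by simp
    finally show "\<exists>g\<in>closed_span M B. sqdist M (\<lambda>x. of_real (indicator A x)) g < \<epsilon>"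
      using comp[OF K(2)] by blast
  qed
  have simple: "s \<in> closed_span M B" if s: "simple_function M s" for s :: "real \<Rightarrow> complex"
  proof -
    have sp: "space M = UNIV" using sets_eq_imp_space_eq[OF sets] by simp
    have eq: "(\<lambda>x. \<Sum>y\<in>range s. y * of_real (indicator (s -` {y}) x)) = s"
    proof
      fix x
      have "s x = (\<Sum>y\<in>range s. indicator (s -` {y}) x *\<^sub>R y)"
        by (rule simple_function_indicator_representation_banach[OF s, of x, unfolded sp Int_UNIV_right, OF UNIV_I])
      also have "\<dots> = (\<Sum>y\<in>range s. y * of_real (indicator (s -` {y}) x))"
        by (simp only: scaleR_conv_of_real mult.commute)
      finally show "(\<Sum>y\<in>range s. y * of_real (indicator (s -` {y}) x)) = s x" ..
    qed
    have "s -` {y} \<in> sets borel" for y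
      using simple_functionD(2)[OF s, of "{y}"] by (simp add: sp sets)
    then have "(\<lambda>x. \<Sum>y\<in>range s. y * of_real (indicator (s -` {y}) x)) \<in> closed_span M B"
      by (intro closed_span_sum[OF B] closed_span_cmult ind)
    then show ?thesis unfolding eq .
  qed
  show ?thesis
  proof
    fix f assume f: "f \<in> L2 M"
    obtain s where s: "\<And>i. simple_function M (s i)" "\<And>x. x \<in> space M \<Longrightarrow> (\<lambda>i. s i x) \<longlonglongrightarrow> f x"
        "\<And>i x. x \<in> space M \<Longrightarrow> dist (s i x) 0 \<le> 2 * dist (f x) 0"
      using borel_measurable_implies_sequence_metric[OF L2_measurable[OF f], of 0] by blast
    show "f \<in> closed_span M B"
    proof (rule closed_span_dominated[OF B f simple[OF s(1)]])
      \<comment> \<open>The simple functions are bounded by twice \<open>cmod (f x)\<close>, so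
        their distance to \<open>f\<close> is at most three times it.\<close>
      show "integrable M (\<lambda>x. (3 * cmod (f x))\<^sup>2)"
        using L2_integrable[OF f] by (simp add: power_mult_distrib)
      show "AE x in M. (\<lambda>n. s n x) \<longlonglongrightarrow> f x" using s(2) by (rule AE_I2)
      show "AE x in M. cmod (s n x - f x) \<le> 3 * cmod (f x)" for n
      proof (rule AE_I2)
        fix x assume "x \<in> space M"
        then show "cmod (s n x - f x) \<le> 3 * cmod (f x)"
          using s(3)[of x n] norm_triangle_ineq4[of "s n x" "f x"] by simp
      qed
    qed
  qed
qed

subsection \<open>The orthonormal basis\<close>

abbreviation M8 :: "real measure" where
  "M8 \<equiv> bernoulli_measure (1/8)"

lemma expo_L2: "expo t \<in> L2 (bernoulli_measure l)"
proof -
  interpret prob_space "bernoulli_measure l" by (rule prob_space_bernoulli_measure)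
  show ?thesis by (rule L2_bounded[of _ 1]) auto
qed

lemma L2_inner_expo: "L2_inner (bernoulli_measure l) (expo s) (expo t) = bernoulli_ft l (s - t)"
  by (simp add: L2_inner_def bernoulli_ft_def expo_mult)

lemma ft8_Union_spectrum_diff:
  assumes "s \<in> (\<Union>n. spectrum n)" "t \<in> (\<Union>n. spectrum n)" "s \<noteq> t"
  shows "ft8 (s - t) = 0"
proof -
  obtain m n where "s \<in> spectrum m" "t \<in> spectrum n" using assms by blast
  then have "s \<in> spectrum (max m n)" "t \<in> spectrum (max m n)"
    using spectrum_mono[of m "max m n"] spectrum_mono[of n "max m n"] by auto
  then show ?thesis using ft8_spectrum_diff assms(3) by blast
qed

lemma orthonormal_expo: "orthonormal_set M8 (expo ` (\<Union>n. spectrum n))"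
  unfolding orthonormal_set_def
proof (intro conjI ballI)
  fix f g assume "f \<in> expo ` (\<Union>n. spectrum n)" "g \<in> expo ` (\<Union>n. spectrum n)"
  then obtain s t where st: "s \<in> (\<Union>n. spectrum n)" "t \<in> (\<Union>n. spectrum n)" "f = expo s" "g = expo t" by blast
  show "L2_inner M8 f g = (if f = g then 1 else 0)"
  proof (cases "s = t")
    case True
    then show ?thesis using st L2_inner_expo[of "1/8" s t] by simp
  next
    case False
    then have zero: "L2_inner M8 f g = 0"
      using ft8_Union_spectrum_diff[OF st(1,2)] st L2_inner_expo[of "1/8" s t] by simp
    \<comment> \<open>Distinct frequencies yield distinct functions, since otherwise the inner
      product would be both 0 and 1.\<close>
    moreover have "L2_inner M8 f f = 1" using st L2_inner_expo[of "1/8" s s] by simp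
    ultimately show ?thesis by auto
  qed
qed (auto intro: expo_L2)

text \<open>The coefficient \<open>ft8 (t - \<gamma>)\<close> is the inner product of
  \<open>expo t\<close> with \<open>expo \<gamma>\<close>, so the sum is the orthogonal projection.
  Expanding the square gives two cross terms of size \<open>Q n t\<close> each, and a double sum
  that orthogonality reduces to its diagonal, again \<open>Q n t\<close>.\<close>

lemma sqdist_projection:
  "sqdist M8 (expo t) (\<lambda>x. \<Sum>\<gamma>\<in>spectrum n. ft8 (t - \<gamma>) * expo \<gamma> x) = 1 - Q n t"
proof -
  define c where "c \<gamma> = ft8 (t - \<gamma>)" for \<gamma>
  have cnj_c: "ft8 (\<gamma> - t) = cnj (c \<gamma>)" for \<gamma>
    using bernoulli_ft_minus[of "1/8" "t - \<gamma>"] by (simp add: c_def)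
  interpret prob_space M8 by (rule prob_space_bernoulli_measure)
  have "complex_of_real (sqdist M8 (expo t) (\<lambda>x. \<Sum>\<gamma>\<in>spectrum n. c \<gamma> * expo \<gamma> x))
      = (\<integral>x. (expo t x - (\<Sum>\<gamma>\<in>spectrum n. c \<gamma> * expo \<gamma> x)) * cnj (expo t x - (\<Sum>\<gamma>\<in>spectrum n. c \<gamma> * expo \<gamma> x)) \<partial>M8)"
    unfolding sqdist_def by (simp only: integral_complex_of_real[symmetric] complex_norm_square)
  also have "\<dots> = (\<integral>x. 1 - (\<Sum>\<gamma>\<in>spectrum n. cnj (c \<gamma>) * expo (t - \<gamma>) x) - (\<Sum>\<gamma>\<in>spectrum n. c \<gamma> * expo (\<gamma> - t) x)
      + (\<Sum>\<gamma>\<in>spectrum n. \<Sum>\<delta>\<in>spectrum n. c \<gamma> * cnj (c \<delta>) * expo (\<gamma> - \<delta>) x) \<partial>M8)"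
  proof (rule Bochner_Integration.integral_cong[OF refl])
    fix x
    have e: "expo (a - b) x = expo a x * expo (- b) x" for a b by (simp add: expo_mult)
    have one: "expo t x * expo (- t) x = 1" by (simp add: expo_mult)
    define S where "S = (\<Sum>\<gamma>\<in>spectrum n. c \<gamma> * expo \<gamma> x)"
    have cS: "cnj S = (\<Sum>\<gamma>\<in>spectrum n. cnj (c \<gamma>) * expo (- \<gamma>) x)"
      by (simp add: S_def)
    have "(expo t x - S) * cnj (expo t x - S) = 1 - expo t x * cnj S - S * expo (- t) x + S * cnj S"
      by (simp add: algebra_simps one)
    moreover have "expo t x * cnj S = (\<Sum>\<gamma>\<in>spectrum n. cnj (c \<gamma>) * expo (t - \<gamma>) x)"
      unfolding cS by (simp add: e sum_distrib_left mult_ac)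
    moreover have "S * expo (- t) x = (\<Sum>\<gamma>\<in>spectrum n. c \<gamma> * expo (\<gamma> - t) x)"
      unfolding S_def by (simp add: e sum_distrib_left mult_ac)
    moreover have "S * cnj S = (\<Sum>\<gamma>\<in>spectrum n. \<Sum>\<delta>\<in>spectrum n. c \<gamma> * cnj (c \<delta>) * expo (\<gamma> - \<delta>) x)"
      unfolding cS unfolding S_def sum_product by (simp add: e mult_ac)
    ultimately show "(expo t x - (\<Sum>\<gamma>\<in>spectrum n. c \<gamma> * expo \<gamma> x)) * cnj (expo t x - (\<Sum>\<gamma>\<in>spectrum n. c \<gamma> * expo \<gamma> x))
      = 1 - (\<Sum>\<gamma>\<in>spectrum n. cnj (c \<gamma>) * expo (t - \<gamma>) x) - (\<Sum>\<gamma>\<in>spectrum n. c \<gamma> * expo (\<gamma> - t) x)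
      + (\<Sum>\<gamma>\<in>spectrum n. \<Sum>\<delta>\<in>spectrum n. c \<gamma> * cnj (c \<delta>) * expo (\<gamma> - \<delta>) x)"
      unfolding S_def by simp
  qed
  also have "\<dots> = 1 - (\<Sum>\<gamma>\<in>spectrum n. cnj (c \<gamma>) * c \<gamma>) - (\<Sum>\<gamma>\<in>spectrum n. c \<gamma> * cnj (c \<gamma>))
      + (\<Sum>\<gamma>\<in>spectrum n. \<Sum>\<delta>\<in>spectrum n. c \<gamma> * cnj (c \<delta>) * ft8 (\<gamma> - \<delta>))"
    by (simp add: prob_space[simplified] flip: bernoulli_ft_def cnj_c) (simp add: c_def)
  also have "(\<Sum>\<gamma>\<in>spectrum n. \<Sum>\<delta>\<in>spectrum n. c \<gamma> * cnj (c \<delta>) * ft8 (\<gamma> - \<delta>)) = (\<Sum>\<gamma>\<in>spectrum n. c \<gamma> * cnj (c \<gamma>))"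
  proof (rule sum.cong[OF refl])
    fix \<gamma> assume \<gamma>: "\<gamma> \<in> spectrum n"
    have "(\<Sum>\<delta>\<in>spectrum n. c \<gamma> * cnj (c \<delta>) * ft8 (\<gamma> - \<delta>)) = (\<Sum>\<delta>\<in>spectrum n. if \<delta> = \<gamma> then c \<gamma> * cnj (c \<gamma>) else 0)"
      using ft8_spectrum_diff[OF \<gamma>] by (intro sum.cong) auto
    then show "(\<Sum>\<delta>\<in>spectrum n. c \<gamma> * cnj (c \<delta>) * ft8 (\<gamma> - \<delta>)) = c \<gamma> * cnj (c \<gamma>)"
      using \<gamma> by simp
  qed
  also have "1 - (\<Sum>\<gamma>\<in>spectrum n. cnj (c \<gamma>) * c \<gamma>) - (\<Sum>\<gamma>\<in>spectrum n. c \<gamma> * cnj (c \<gamma>)) + (\<Sum>\<gamma>\<in>spectrum n. c \<gamma> * cnj (c \<gamma>))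
      = complex_of_real (1 - Q n t)"
    by (simp add: Q_def c_def complex_norm_square mult.commute del: of_real_power)
  finally show ?thesis unfolding c_def of_real_eq_iff .
qed

text \<open>The squared distance to the projection is \<open>1 - Q n t\<close>, which tends to 0
  because \<open>Qlim\<close> is 1 everywhere.\<close>

lemma expo_in_closed_span: "expo t \<in> closed_span M8 (expo ` (\<Union>n. spectrum n))"
proof (rule closed_spanI[OF expo_L2])
  fix \<epsilon> :: real assume \<epsilon>: "0 < \<epsilon>"
  have "\<forall>\<^sub>F n in sequentially. 1 - \<epsilon> < Q n t"
    using Q_tendsto[of t] \<epsilon> by (intro order_tendstoD(1)[of _ 1]) (simp_all add: Qlim_eq_1)
  then obtain n where n: "1 - \<epsilon> < Q n t" by (auto simp: eventually_sequentially)
  have "(\<lambda>x. \<Sum>\<gamma>\<in>spectrum n. ft8 (t - \<gamma>) * expo \<gamma> x) \<in> fspan (expo ` (\<Union>n. spectrum n))"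
    by (intro fspan_sum fspan_cmult fspan_base) auto
  moreover have "sqdist M8 (expo t) (\<lambda>x. \<Sum>\<gamma>\<in>spectrum n. ft8 (t - \<gamma>) * expo \<gamma> x) < \<epsilon>"
    using n by (simp add: sqdist_projection)
  ultimately show "\<exists>h\<in>fspan (expo ` (\<Union>n. spectrum n)). sqdist M8 (expo t) h < \<epsilon>" by blast
qed

theorem theoremA:
  "orthonormal_basis (bernoulli_measure (1/8)) (exponentials ((\<lambda>\<gamma>. 3 * \<gamma>) ` Gamma_eighth))"
  unfolding exponentials_eq three_Gamma_eighth
proof (rule orthonormal_basisI[OF orthonormal_expo L2_subset_closed_span])
  show "AE x in M8. \<bar>x\<bar> \<le> 1"
    using AE_bernoulli_measure_bounded[of "1/8"] by (auto elim!: eventually_mono)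
qed (auto intro: prob_space_bernoulli_measure expo_L2 expo_in_closed_span)

end
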